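(* Let $U$ be a nonempty set. Over $U$, general validity is strictly included in standard validity, $\models^d\subsetneq\models^{d'}$: every MSO formula $\varphi$ with $\models^d\varphi$ satisfies $\models^{d'}\varphi$, whereas for a binary relation symbol $P$, a first-order variable $x$ and a monadic variable $X$, the formula $$\exists X.\,\forall x.\,(X(x)\leftrightarrow P(x,x))$$ satisfies $\models^{d'}$ but not $\models^d$.
   Context: **Syntax.** Relation symbols $R=\mathbb N$, first-order variables $V=\mathbb N$ and second-order (monadic) variables $V_2=\mathbb N$ (the two kinds of variables form separate namespaces). MSO formulas: $\varphi,\psi ::= r(x,y)\mid X(x)\mid\neg\varphi\mid\varphi\wedge\psi\mid\exists x.\varphi\mid\exists X.\varphi$ with $r\in R$, $x,y\in V$, $X\in V_2$ (no equality). The connectives $\vee,\supset,\leftrightarrow$ and the universals $\forall x.\varphi:=\neg\exists x.\neg\varphi$, $\forall X.\varphi:=\neg\exists X.\neg\varphi$ are the usual abbreviations. **Semantics.** $U$ is a fixed nonempty set (the type of individuals). An interpretation $I$ over $U$ assigns to each $r\in R$ a binary relation $I(r)\subseteq U\times U$. Given $I$, a set $D\subseteq U$, a family $E\subseteq\mathcal P(U)$ (no closure condition on $E$), and assignments $g:V\to U$, $G:V_2\to\mathcal P(U)$, truth $\langle I,D,E\rangle,g,G\models^d\varphi$ is defined recursively: $r(x,y)$ holds iff $(g(x),g(y))\in I(r)$; $X(x)$ holds iff $g(x)\in G(X)$; $\neg,\wedge$ are classical; $\exists x.\varphi$ holds iff $\langle I,D,E\rangle,g[x\leftarrow d],G\models^d\varphi$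 for some $d\in D$; $\exists X.\varphi$ holds iff $\langle I,D,E\rangle,g,G\langle X\leftarrow S\rangle\models^d\varphi$ for some $S\in E$. Here $g[x\leftarrow d]$ and $G\langle X\leftarrow S\rangle$ are the usual updates. **General validity.** $\models^d\varphi$ means: for all $I$, $D\subseteq U$, $E\subseteq\mathcal P(U)$, all $g$ with $\mathrm{Range}(g)\subseteq D$ and all $G$ with $\mathrm{Range}(G)\subseteq E$, $\langle I,D,E\rangle,g,G\models^d\varphi$. **Standard validity.** $\models^{d'}\varphi$ means: for all $I$, $g:V\to U$, $G:V_2\to\mathcal P(U)$, $\langle I,U,\mathcal P(U)\rangle,g,G\models^d\varphi$. *)

theory Defs
  imports Main
begin

type_synonym rsym = nat
type_synonym var = nat
type_synonym var2 = nat

datatype mso =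
    Rel rsym var var
  | Mem var2 var
  | Neg mso
  | Conj mso mso
  | Ex1 var mso
  | Ex2 var2 mso

abbreviation Disj :: "mso \<Rightarrow> mso \<Rightarrow> mso" where
  "Disj \<phi> \<psi> \<equiv> Neg (Conj (Neg \<phi>) (Neg \<psi>))"

abbreviation Impl :: "mso \<Rightarrow> mso \<Rightarrow> mso" where
  "Impl \<phi> \<psi> \<equiv> Disj (Neg \<phi>) \<psi>"

abbreviation Equi :: "mso \<Rightarrow> mso \<Rightarrow> mso" where
  "Equi \<phi> \<psi> \<equiv> Conj (Impl \<phi> \<psi>) (Impl \<psi> \<phi>)"

abbreviation All1 :: "var \<Rightarrow> mso \<Rightarrow> mso" where
  "All1 x \<phi> \<equiv> Neg (Ex1 x (Neg \<phi>))"

abbreviation All2 :: "var2 \<Rightarrow> mso \<Rightarrow> mso" where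
  "All2 X \<phi> \<equiv> Neg (Ex2 X (Neg \<phi>))"

text \<open>The nonempty set of individuals is the type \<open>'u\<close> itself.\<close>

type_synonym 'u interp = "rsym \<Rightarrow> ('u \<times> 'u) set"

primrec sat ::
  "'u interp \<Rightarrow> 'u set \<Rightarrow> 'u set set \<Rightarrow> (var \<Rightarrow> 'u) \<Rightarrow> (var2 \<Rightarrow> 'u set) \<Rightarrow> mso \<Rightarrow> bool"
where
  "sat I D E g G (Rel r x y) \<longleftrightarrow> (g x, g y) \<in> I r"
| "sat I D E g G (Mem X x) \<longleftrightarrow> g x \<in> G X"
| "sat I D E g G (Neg \<phi>) \<longleftrightarrow> \<not> sat I D E g G \<phi>"
| "sat I D E g G (Conj \<phi> \<psi>) \<longleftrightarrow> sat I D E g G \<phi> \<and> sat I D E g G \<psi>"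
| "sat I D E g G (Ex1 x \<phi>) \<longleftrightarrow> (\<exists>d\<in>D. sat I D E (g(x := d)) G \<phi>)"
| "sat I D E g G (Ex2 X \<phi>) \<longleftrightarrow> (\<exists>S\<in>E. sat I D E g (G(X := S)) \<phi>)"

text \<open>Validity depends on the set of individuals, which a formula does not mention; the
  argument of type \<open>'u itself\<close> supplies it.\<close>

definition general_valid :: "'u itself \<Rightarrow> mso \<Rightarrow> bool" where
  "general_valid (_ :: 'u itself) \<phi> \<longleftrightarrow>
     (\<forall>(I :: 'u interp) D E g G.
        range g \<subseteq> D \<longrightarrow> range G \<subseteq> E \<longrightarrow> sat I D E g G \<phi>)"

definition standard_valid :: "'u itself \<Rightarrow> mso \<Rightarrow> bool" where
  "standard_valid (_ :: 'u itself) \<phi> \<longleftrightarrow>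
     (\<forall>(I :: 'u interp) g G. sat I UNIV (Pow UNIV) g G \<phi>)"

end

theory Submission imports Defs begin

text \<open>Standard models are the general ones with \<open>D = UNIV\<close> and
  \<open>E = Pow UNIV\<close>, where the range conditions hold trivially; hence the inclusion. It is
  strict because the formula is an instance of comprehension: the full power set contains the set
  that \<open>P\<close> defines on the diagonal, an arbitrary \<open>E\<close> need not.\<close>

lemma general_valid_imp_standard_valid:
  "general_valid TYPE('u) \<phi> \<Longrightarrow> standard_valid TYPE('u) \<phi>"
  by (simp add: general_valid_def standard_valid_def)

lemma comprehension_standard_valid:
  "standard_valid TYPE('u) (Ex2 X (All1 x (Equi (Mem X x) (Rel P x x))))"
  unfolding standard_valid_def
proof (intro allI)
  fix I :: "'u interp" and g G
  show "sat I UNIV (Pow UNIV) g G (Ex2 X (All1 x (Equi (Mem X x) (Rel P x x))))"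
    by (auto intro!: exI[of _ "{d. (d, d) \<in> I P}"])
qed

text \<open>The family whose only member is the empty set omits the set defined by a total \<open>P\<close>.\<close>

lemma comprehension_not_general_valid:
  "\<not> general_valid TYPE('u) (Ex2 X (All1 x (Equi (Mem X x) (Rel P x x))))"
proof
  assume valid: "general_valid TYPE('u) (Ex2 X (All1 x (Equi (Mem X x) (Rel P x x))))"
  \<comment> \<open>Constant assignments keep the ranges inside \<open>UNIV\<close> and
    \<open>{{}}\<close>, as general validity demands.\<close>
  have "sat (\<lambda>_. UNIV :: ('u \<times> 'u) set) UNIV {{}} (\<lambda>_. undefined) (\<lambda>_. {})
      (Ex2 X (All1 x (Equi (Mem X x) (Rel P x x))))"
    by (rule valid[unfolded general_valid_def, rule_format]) auto
  \<comment> \<open>\<open>X\<close> can only be empty, while every \<open>d\<close> satisfies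
    \<open>P(d,d)\<close>; since types are nonempty, some \<open>d\<close> refutes the
    equivalence.\<close>
  then show False by simp
qed

theorem mainTheorem5:
  shows "{\<phi>. general_valid TYPE('u) \<phi>} \<subset> {\<phi>. standard_valid TYPE('u) \<phi>} \<and>
    (\<forall>\<phi>. general_valid TYPE('u) \<phi> \<longrightarrow> standard_valid TYPE('u) \<phi>) \<and>
    (\<forall>(P :: rsym) (x :: var) (X :: var2).
      standard_valid TYPE('u) (Ex2 X (All1 x (Equi (Mem X x) (Rel P x x)))) \<and>
      \<not> general_valid TYPE('u) (Ex2 X (All1 x (Equi (Mem X x) (Rel P x x)))))"
  using general_valid_imp_standard_valid comprehension_standard_valid
    comprehension_not_general_valid
  by blast

end
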